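(* Let $G=(V=[n],E)$ be a graph with maximal cliques $V_1,\dots,V_p$, let $f_0,\dots,f_N,g_1,\dots,g_m\in\mathbb{R}[x_1,\dots,x_n]$, $a_1,\dots,a_N\in\mathbb{R}$, and let $$K=\{x\in\mathbb{R}^n:\ g_j(x)\ge 0\ (j\in[m]),\ x_ix_j=0\ (\{i,j\}\in\overline{E})\}.$$ For $k\in[p]$ set $K_k=\{y\in\mathbb{R}^{|V_k|}:\ (y,0_{V\setminus V_k})\in K\}$. Define $$\mathrm{val}=\inf_{\mu\in\mathscr{M}(\mathbb{R}^n)}\Big\{\int f_0\,d\mu:\ \int f_i\,d\mu=a_i\ (i\in[N]),\ \mathrm{Supp}(\mu)\subseteq K\Big\}$$ and $$\mathrm{val}^{\mathrm{isp}}=\inf_{\mu_k\in\mathscr{M}(\mathbb{R}^{|V_k|}),\,k\in[p]}\Big\{\sum_{k=1}^p\int f_{0|V_k}\,d\mu_k:\ \sum_{k=1}^p\int f_{i|V_k}\,d\mu_k=a_i\ (i\in[N]),\ \mathrm{Supp}(\mu_k)\subseteq K_k\ (k\in[p])\Big\}.$$ Then the two problems are equivalent, i.e., their optimum values are equal: $\mathrm{val}=\mathrm{val}^{\mathrm{isp}}$.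
   Context: Notation: $[n]=\{1,\dots,n\}$. $E$ is a set of pairs of distinct elements of $V=[n]$, and $\overline{E}$ is the set of pairs $\{i,j\}$ with $i\neq j\in V$ and $\{i,j\}\notin E$ (the non-edges of $G$). A set $W\subseteq V$ is a clique of $G$ if any two distinct elements of $W$ form an edge; it is maximal if not strictly contained in another clique. For $U\subseteq V$ and $y\in\mathbb{R}^{|U|}$ (indexed by $U$), $(y,0_{V\setminus U})\in\mathbb{R}^n$ is obtained by padding $y$ with zeros at the entries indexed by $V\setminus U$; for $f:\mathbb{R}^{n}\to\mathbb{R}$, $f_{|U}:\mathbb{R}^{|U|}\to\mathbb{R}$ is $f_{|U}(y)=f(y,0_{V\setminus U})$. $\mathscr{M}(\mathbb{R}^d)$ is the set of finite positive Borel measures on $\mathbb{R}^d$. The condition $\mathrm{Supp}(\mu)\subseteq K$ means $\int f\,d\mu=\int_K f\,d\mu$ for every Borel measurable $f$ (i.e. the complement of $K$ has $\mu$-measure zero), and similarly for $\mu_k$ and $K_k$. All integrals appearing in the two problems are required to exist and be finite for a measure (or tuple of measures) to be feasible. The infimum over the empty set is $+\infty$. *)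

theory Defs
  imports "HOL-Analysis.Analysis" "HOL-Library.Poly_Mapping"
begin

text \<open>A polynomial is a finitely supported map from monomials to coefficients; a monomial is a
  finitely supported map from variable indices to exponents.\<close>

type_synonym rpoly = "(nat \<Rightarrow>\<^sub>0 nat) \<Rightarrow>\<^sub>0 real"

definition polys :: "nat \<Rightarrow> rpoly set" where
  "polys n = {p. \<forall>t\<in>Poly_Mapping.keys p. Poly_Mapping.keys t \<subseteq> {1..n}}"

definition peval :: "rpoly \<Rightarrow> (nat \<Rightarrow> real) \<Rightarrow> real" where
  "peval p x = (\<Sum>t\<in>Poly_Mapping.keys p.
     Poly_Mapping.lookup p t * (\<Prod>i\<in>Poly_Mapping.keys t. x i ^ Poly_Mapping.lookup t i))"

definition graph_on :: "nat set \<Rightarrow> nat set set \<Rightarrow> bool" where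
  "graph_on V E \<longleftrightarrow> E \<subseteq> {{i, j} | i j. i \<in> V \<and> j \<in> V \<and> i \<noteq> j}"

definition non_edges :: "nat set \<Rightarrow> nat set set \<Rightarrow> nat set set" where
  "non_edges V E = {{i, j} | i j. i \<in> V \<and> j \<in> V \<and> i \<noteq> j \<and> {i, j} \<notin> E}"

definition clique :: "nat set \<Rightarrow> nat set set \<Rightarrow> nat set \<Rightarrow> bool" where
  "clique V E W \<longleftrightarrow> W \<subseteq> V \<and> (\<forall>i\<in>W. \<forall>j\<in>W. i \<noteq> j \<longrightarrow> {i, j} \<in> E)"

definition maximal_clique :: "nat set \<Rightarrow> nat set set \<Rightarrow> nat set \<Rightarrow> bool" where
  "maximal_clique V E W \<longleftrightarrow> clique V E W \<and> \<not> (\<exists>W'. clique V E W' \<and> W \<subset> W')"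

text \<open>For a finite index set \<open>U\<close>, the space \<open>\<real>\<^sup>U\<close> consists of the functions that are
  \<open>undefined\<close> outside \<open>U\<close>. Since \<open>U\<close> is finite and \<open>\<real>\<close> is second countable, the product
  sigma-algebra is the Borel sigma-algebra of \<open>\<real>\<^sup>U\<close>.\<close>

abbreviation borel_on :: "nat set \<Rightarrow> (nat \<Rightarrow> real) measure" where
  "borel_on U \<equiv> Pi\<^sub>M U (\<lambda>_. borel)"

definition zero_pad :: "nat set \<Rightarrow> nat set \<Rightarrow> (nat \<Rightarrow> real) \<Rightarrow> nat \<Rightarrow> real" where
  "zero_pad V U y = (\<lambda>i\<in>V. if i \<in> U then y i else 0)"

definition restrict_fun ::
  "nat set \<Rightarrow> nat set \<Rightarrow> ((nat \<Rightarrow> real) \<Rightarrow> real) \<Rightarrow> (nat \<Rightarrow> real) \<Rightarrow> real" where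
  "restrict_fun V U f = (\<lambda>y. f (zero_pad V U y))"

definition finite_borel_measures :: "nat set \<Rightarrow> (nat \<Rightarrow> real) measure set" where
  "finite_borel_measures U = {\<mu>. sets \<mu> = sets (borel_on U) \<and> finite_measure \<mu>}"

definition supported_in :: "'a measure \<Rightarrow> 'a set \<Rightarrow> bool" where
  "supported_in \<mu> K \<longleftrightarrow> space \<mu> - K \<in> null_sets \<mu>"

definition feasible_set ::
  "nat \<Rightarrow> nat set set \<Rightarrow> nat \<Rightarrow> (nat \<Rightarrow> rpoly) \<Rightarrow> (nat \<Rightarrow> real) set" where
  "feasible_set n E m g = {x \<in> space (borel_on {1..n}).
     (\<forall>j\<in>{1..m}. peval (g j) x \<ge> 0) \<and>
     (\<forall>i j. {i, j} \<in> non_edges {1..n} E \<longrightarrow> x i * x j = 0)}"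

definition clique_feasible_set ::
  "nat \<Rightarrow> nat set set \<Rightarrow> nat \<Rightarrow> (nat \<Rightarrow> rpoly) \<Rightarrow> nat set \<Rightarrow> (nat \<Rightarrow> real) set" where
  "clique_feasible_set n E m g U =
     {y \<in> space (borel_on U). zero_pad {1..n} U y \<in> feasible_set n E m g}"

text \<open>Values are extended reals: the infimum over the empty set is \<open>\<infinity>\<close>, and an unbounded
  problem has value \<open>-\<infinity>\<close>. As the Bochner integral is \<open>0\<close> on non-integrable functions,
  integrability is part of feasibility.\<close>

definition dense_feasible ::
  "nat \<Rightarrow> nat set set \<Rightarrow> nat \<Rightarrow> (nat \<Rightarrow> rpoly) \<Rightarrow> nat \<Rightarrow> (nat \<Rightarrow> rpoly) \<Rightarrow> (nat \<Rightarrow> real)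
   \<Rightarrow> (nat \<Rightarrow> real) measure \<Rightarrow> bool" where
  "dense_feasible n E m g N f a \<mu> \<longleftrightarrow>
     \<mu> \<in> finite_borel_measures {1..n} \<and>
     (\<forall>i\<in>{0..N}. integrable \<mu> (peval (f i))) \<and>
     (\<forall>i\<in>{1..N}. (\<integral>x. peval (f i) x \<partial>\<mu>) = a i) \<and>
     supported_in \<mu> (feasible_set n E m g)"

definition dense_val ::
  "nat \<Rightarrow> nat set set \<Rightarrow> nat \<Rightarrow> (nat \<Rightarrow> rpoly) \<Rightarrow> nat \<Rightarrow> (nat \<Rightarrow> rpoly) \<Rightarrow> (nat \<Rightarrow> real)
   \<Rightarrow> ereal" where
  "dense_val n E m g N f a =
     Inf {ereal (\<integral>x. peval (f 0) x \<partial>\<mu>) | \<mu>. dense_feasible n E m g N f a \<mu>}"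

definition sparse_feasible ::
  "nat \<Rightarrow> nat set set \<Rightarrow> nat \<Rightarrow> (nat \<Rightarrow> nat set) \<Rightarrow> nat \<Rightarrow> (nat \<Rightarrow> rpoly)
   \<Rightarrow> nat \<Rightarrow> (nat \<Rightarrow> rpoly) \<Rightarrow> (nat \<Rightarrow> real) \<Rightarrow> (nat \<Rightarrow> (nat \<Rightarrow> real) measure) \<Rightarrow> bool" where
  "sparse_feasible n E p C m g N f a \<mu> \<longleftrightarrow>
     (\<forall>k\<in>{1..p}. \<mu> k \<in> finite_borel_measures (C k)) \<and>
     (\<forall>k\<in>{1..p}. \<forall>i\<in>{0..N}. integrable (\<mu> k) (restrict_fun {1..n} (C k) (peval (f i)))) \<and>
     (\<forall>i\<in>{1..N}. (\<Sum>k\<in>{1..p}. \<integral>y. restrict_fun {1..n} (C k) (peval (f i)) y \<partial>\<mu> k) = a i) \<and>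
     (\<forall>k\<in>{1..p}. supported_in (\<mu> k) (clique_feasible_set n E m g (C k)))"

definition sparse_val ::
  "nat \<Rightarrow> nat set set \<Rightarrow> nat \<Rightarrow> (nat \<Rightarrow> nat set) \<Rightarrow> nat \<Rightarrow> (nat \<Rightarrow> rpoly)
   \<Rightarrow> nat \<Rightarrow> (nat \<Rightarrow> rpoly) \<Rightarrow> (nat \<Rightarrow> real) \<Rightarrow> ereal" where
  "sparse_val n E p C m g N f a =
     Inf {ereal (\<Sum>k\<in>{1..p}. \<integral>y. restrict_fun {1..n} (C k) (peval (f 0)) y \<partial>\<mu> k) | \<mu>.
          sparse_feasible n E p C m g N f a \<mu>}"

end

theory Submission
  imports Defs
begin

text \<open>
  A point \<open>x\<close> satisfying \<open>x\<^sub>i x\<^sub>j = 0\<close> on all non-edges has a clique as its support: two distinct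
  indices \<open>i, j\<close> with \<open>x\<^sub>i \<noteq> 0\<close> and \<open>x\<^sub>j \<noteq> 0\<close> cannot form a non-edge. Hence \<open>K\<close> is the union of
  the zero-padded copies of the sets \<open>K\<^sub>k\<close>, one for each maximal clique, and measures can be moved
  between the two descriptions without changing any integral:

  \<^item> A family \<open>(\<nu>\<^sub>k)\<close> is glued into the sum of the pushforwards of the \<open>\<nu>\<^sub>k\<close> along zero-padding
    (\<open>glue_measures\<close>).
  \<^item> A measure \<open>\<mu>\<close> on \<open>K\<close> is split along the partition of \<open>K\<close> that assigns each point to the first
    clique containing its support; the part on the \<open>k\<close>-th piece is pushed forward along the
    coordinate restriction to that clique (\<open>split_measure\<close>). On the piece this restriction is
    inverted by zero-padding, so integrals are kept although the copies of the \<open>K\<^sub>k\<close> may overlap.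

  Both constructions preserve the integral of every measurable function (if it exists), in
  particular feasibility and the objective. So the two problems attain exactly the same set of
  objective values, and their infima agree.
\<close>

section \<open>Finite sums of measures\<close>

text \<open>The measure \<open>M\<close> serves only to fix the underlying measurable space, which would otherwise be
  undetermined for an empty index set.\<close>

definition sum_measure :: "'a measure \<Rightarrow> 'i set \<Rightarrow> ('i \<Rightarrow> 'a measure) \<Rightarrow> 'a measure" where
  "sum_measure M I \<nu> = measure_of (space M) (sets M) (\<lambda>A. \<Sum>k\<in>I. emeasure (\<nu> k) A)"

lemma space_sum_measure [simp]: "space (sum_measure M I \<nu>) = space M"
  and sets_sum_measure [simp, measurable_cong]: "sets (sum_measure M I \<nu>) = sets M"
  by (simp_all add: sum_measure_def)

lemma emeasure_sum_measure:
  fixes M :: "'a measure"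
  assumes "\<And>k. k \<in> I \<Longrightarrow> sets (\<nu> k) = sets M" and "A \<in> sets M"
  shows "emeasure (sum_measure M I \<nu>) A = (\<Sum>k\<in>I. emeasure (\<nu> k) A)"
proof (rule emeasure_measure_of[OF sum_measure_def])
  show "countably_additive (sets (sum_measure M I \<nu>)) (\<lambda>A. \<Sum>k\<in>I. emeasure (\<nu> k) A)"
  proof (rule countably_additiveI)
    fix B :: "nat \<Rightarrow> 'a set"
    assume B: "range B \<subseteq> sets (sum_measure M I \<nu>)" "disjoint_family B"
    have "suminf (\<lambda>i. \<Sum>k\<in>I. emeasure (\<nu> k) (B i)) = (\<Sum>k\<in>I. suminf (\<lambda>i. emeasure (\<nu> k) (B i)))"
      by (rule suminf_sum) simp
    also have "\<dots> = (\<Sum>k\<in>I. emeasure (\<nu> k) (\<Union>i. B i))"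
      using B assms(1) by (intro sum.cong refl suminf_emeasure) auto
    finally show "suminf (\<lambda>i. \<Sum>k\<in>I. emeasure (\<nu> k) (B i)) = (\<Sum>k\<in>I. emeasure (\<nu> k) (\<Union>i. B i))" .
  qed
qed (use assms sets.space_closed[of M] in \<open>auto simp: positive_def\<close>)

lemma nn_integral_sum_measure:
  fixes M :: "'a measure"
  assumes "\<And>k. k \<in> I \<Longrightarrow> sets (\<nu> k) = sets M" and "u \<in> borel_measurable M"
  shows "(\<integral>\<^sup>+x. u x \<partial>sum_measure M I \<nu>) = (\<Sum>k\<in>I. \<integral>\<^sup>+x. u x \<partial>\<nu> k)"
proof -
  have meas: "v \<in> borel_measurable (\<nu> k)" if "v \<in> borel_measurable M" "k \<in> I"
    for v :: "'a \<Rightarrow> ennreal" and k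
    using that assms(1) measurable_cong_sets by blast
  have meas': "v \<in> borel_measurable (sum_measure M I \<nu>)" if "v \<in> borel_measurable M"
    for v :: "'a \<Rightarrow> ennreal"
    using that by simp
  have space: "space (\<nu> k) = space M" if "k \<in> I" for k
    using that assms(1) sets_eq_imp_space_eq by blast
  from assms(2) show ?thesis
  proof (induction rule: borel_measurable_induct)
    case (cong u v)
    have "(\<integral>\<^sup>+x. u x \<partial>sum_measure M I \<nu>) = (\<integral>\<^sup>+x. v x \<partial>sum_measure M I \<nu>)"
      using cong by (intro nn_integral_cong) simp
    moreover have "(\<Sum>k\<in>I. \<integral>\<^sup>+x. u x \<partial>\<nu> k) = (\<Sum>k\<in>I. \<integral>\<^sup>+x. v x \<partial>\<nu> k)"
      using cong space by (intro sum.cong refl nn_integral_cong) simp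
    ultimately show ?case using cong by simp
  next
    case (set A)
    then show ?case
      using assms(1) by (simp add: emeasure_sum_measure)
  next
    case (mult u c)
    have "(\<Sum>k\<in>I. \<integral>\<^sup>+x. c * u x \<partial>\<nu> k) = (\<Sum>k\<in>I. c * \<integral>\<^sup>+x. u x \<partial>\<nu> k)"
      by (intro sum.cong refl nn_integral_cmult meas mult(2))
    with mult show ?case
      by (simp add: nn_integral_cmult[OF meas'] sum_distrib_left)
  next
    case (add u v)
    have "(\<Sum>k\<in>I. \<integral>\<^sup>+x. v x + u x \<partial>\<nu> k) = (\<Sum>k\<in>I. (\<integral>\<^sup>+x. v x \<partial>\<nu> k) + (\<integral>\<^sup>+x. u x \<partial>\<nu> k))"
      by (intro sum.cong refl nn_integral_add meas add(1) add(3))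
    with add show ?case
      by (simp add: nn_integral_add[OF meas' meas'] sum.distrib)
  next
    case (seq U)
    have mono: "incseq (\<lambda>i. \<integral>\<^sup>+x. U i x \<partial>\<nu> k)" for k
      using seq(3) by (auto intro!: incseq_SucI nn_integral_mono dest: incseq_SucD le_funD)
    have "(\<integral>\<^sup>+x. Sup (range U) x \<partial>sum_measure M I \<nu>) = (SUP i. \<integral>\<^sup>+x. U i x \<partial>sum_measure M I \<nu>)"
      unfolding SUP_apply by (intro nn_integral_monotone_convergence_SUP seq meas')
    also have "\<dots> = (SUP i. \<Sum>k\<in>I. \<integral>\<^sup>+x. U i x \<partial>\<nu> k)"
      by (simp only: seq)
    also have "\<dots> = (\<Sum>k\<in>I. SUP i. \<integral>\<^sup>+x. U i x \<partial>\<nu> k)"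
      by (intro incseq_sumI2 ennreal_SUP_sum mono)
    also have "\<dots> = (\<Sum>k\<in>I. \<integral>\<^sup>+x. Sup (range U) x \<partial>\<nu> k)"
      unfolding SUP_apply
      by (intro sum.cong refl nn_integral_monotone_convergence_SUP[symmetric] seq meas)
    finally show ?case .
  qed
qed

lemma finite_measure_sum_measure:
  assumes "finite I" and "\<And>k. k \<in> I \<Longrightarrow> sets (\<nu> k) = sets M"
    and "\<And>k. k \<in> I \<Longrightarrow> finite_measure (\<nu> k)"
  shows "finite_measure (sum_measure M I \<nu>)"
  by (rule finite_measureI)
    (use assms in \<open>auto simp: emeasure_sum_measure finite_measure.emeasure_finite\<close>)

text \<open>The additivity of the nonnegative integral in the measure carries over by writing the integral
  of \<open>f\<close> as the difference of the nonnegative integrals of \<open>f\<close> and \<open>-f\<close>, all finite here.\<close>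

lemma
  fixes f :: "'a \<Rightarrow> real"
  assumes "finite I" and sets: "\<And>k. k \<in> I \<Longrightarrow> sets (\<nu> k) = sets M"
    and f: "\<And>k. k \<in> I \<Longrightarrow> integrable (\<nu> k) f" "f \<in> borel_measurable M"
  shows integrable_sum_measure: "integrable (sum_measure M I \<nu>) f"
    and integral_sum_measure: "(\<integral>x. f x \<partial>sum_measure M I \<nu>) = (\<Sum>k\<in>I. \<integral>x. f x \<partial>\<nu> k)"
proof -
  have fin: "(\<integral>\<^sup>+x. ennreal (s * f x) \<partial>\<nu> k) < \<infinity>" if "k \<in> I" "\<bar>s\<bar> = 1" for s k
  proof -
    have "(\<integral>\<^sup>+x. ennreal (s * f x) \<partial>\<nu> k) \<le> (\<integral>\<^sup>+x. ennreal (norm (f x)) \<partial>\<nu> k)"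
      using that by (intro nn_integral_mono ennreal_leI) (auto simp: abs_if split: if_splits)
    also have "\<dots> < \<infinity>"
      using f(1)[OF that(1)] by (simp add: integrable_iff_bounded)
    finally show ?thesis .
  qed
  have nn: "(\<integral>\<^sup>+x. ennreal (s * f x) \<partial>sum_measure M I \<nu>) = (\<Sum>k\<in>I. \<integral>\<^sup>+x. ennreal (s * f x) \<partial>\<nu> k)" for s
    using sets f(2) by (intro nn_integral_sum_measure) auto
  have "(\<integral>\<^sup>+x. ennreal (norm (f x)) \<partial>sum_measure M I \<nu>) = (\<Sum>k\<in>I. \<integral>\<^sup>+x. ennreal (norm (f x)) \<partial>\<nu> k)"
    using sets f(2) by (intro nn_integral_sum_measure) auto
  also have "\<dots> < \<infinity>"
    using f(1) \<open>finite I\<close> by (simp add: integrable_iff_bounded)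
  finally show int: "integrable (sum_measure M I \<nu>) f"
    using f(2) by (simp add: integrable_iff_bounded)
  show "(\<integral>x. f x \<partial>sum_measure M I \<nu>) = (\<Sum>k\<in>I. \<integral>x. f x \<partial>\<nu> k)"
    using int f(1) nn[of 1] nn[of "-1"] fin[of _ 1] fin[of _ "-1"]
    by (simp add: real_lebesgue_integral_def enn2real_sum sum_subtractf)
qed

section \<open>Measurability of zero-padding and of the feasible sets\<close>

lemma measurable_zero_pad [measurable]: "zero_pad V U \<in> borel_on U \<rightarrow>\<^sub>M borel_on V"
  unfolding zero_pad_def
proof (rule measurable_restrict)
  fix i
  show "(\<lambda>y. if i \<in> U then y i else 0) \<in> borel_on U \<rightarrow>\<^sub>M (borel :: real measure)"
    by (cases "i \<in> U") simp_all
qed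

lemma zero_pad_restrict:
  assumes "x \<in> space (borel_on V)" and "{i \<in> V. x i \<noteq> 0} \<subseteq> U"
  shows "zero_pad V U (restrict x U) = x"
  using assms by (auto simp: zero_pad_def space_PiM PiE_def extensional_def fun_eq_iff)

lemma measurable_peval:
  assumes "q \<in> polys n"
  shows "peval q \<in> borel_measurable (borel_on {1..n})"
proof -
  have "i \<in> {1..n}" if "t \<in> Poly_Mapping.keys q" "i \<in> Poly_Mapping.keys t" for t i
    using assms that unfolding polys_def by blast
  then show ?thesis
    unfolding peval_def
    by (intro borel_measurable_sum borel_measurable_times borel_measurable_const
        borel_measurable_prod borel_measurable_power measurable_component_singleton) blast+
qed

lemma sets_feasible_set:
  assumes "\<And>j. j \<in> {1..m} \<Longrightarrow> g j \<in> polys n"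
  shows "feasible_set n E m g \<in> sets (borel_on {1..n})"
proof -
  have "{x \<in> space (borel_on {1..n}). 0 \<le> peval (g j) x} \<in> sets (borel_on {1..n})"
    if "j \<in> {1..m}" for j
    using measurable_peval[OF assms[OF that]] by measurable
  moreover have "{x \<in> space (borel_on {1..n}). {i, j} \<in> non_edges {1..n} E \<longrightarrow> x i * x j = 0}
      \<in> sets (borel_on {1..n})" for i j
  proof (cases "{i, j} \<in> non_edges {1..n} E")
    case True
    then have "i \<in> {1..n}" "j \<in> {1..n}"
      by (auto simp: non_edges_def doubleton_eq_iff)
    then show ?thesis by measurable
  qed simp
  ultimately show ?thesis
    unfolding feasible_set_def
    by (intro sets.sets_Collect_conj sets.sets_Collect_finite_All sets.sets_Collect_countable_All)
      simp_all
qed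

lemma sets_clique_feasible_set:
  assumes "\<And>j. j \<in> {1..m} \<Longrightarrow> g j \<in> polys n"
  shows "clique_feasible_set n E m g U \<in> sets (borel_on U)"
proof -
  have "clique_feasible_set n E m g U
      = zero_pad {1..n} U -` feasible_set n E m g \<inter> space (borel_on U)"
    by (auto simp: clique_feasible_set_def)
  then show ?thesis
    using measurable_sets[OF measurable_zero_pad sets_feasible_set[OF assms]] by simp
qed

lemma supported_in_iff_AE:
  assumes "K \<in> sets \<mu>"
  shows "supported_in \<mu> K \<longleftrightarrow> (AE x in \<mu>. x \<in> K)"
proof -
  have "{x \<in> space \<mu>. x \<notin> K} = space \<mu> - K" by auto
  then show ?thesis
    using assms AE_iff_null[of \<mu> "\<lambda>x. x \<in> K"] by (simp add: supported_in_def)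
qed

section \<open>Supports of feasible points\<close>

lemma clique_subset_maximal_clique:
  assumes "finite V" and "clique V E S"
  obtains W where "maximal_clique V E W" and "S \<subseteq> W"
proof -
  have "finite {W. clique V E W}"
    by (rule finite_subset[of _ "Pow V"]) (use \<open>finite V\<close> in \<open>auto simp: clique_def\<close>)
  then obtain W where "W \<in> {W. clique V E W}" "S \<subseteq> W"
    "\<forall>W'\<in>{W. clique V E W}. W \<subseteq> W' \<longrightarrow> W' = W"
    using finite_has_maximal2[of "{W. clique V E W}" S] assms(2) by blast
  then show thesis
    by (intro that[of W]) (auto simp: maximal_clique_def)
qed

lemma clique_support:
  assumes "x \<in> feasible_set n E m g"
  shows "clique {1..n} E {i \<in> {1..n}. x i \<noteq> 0}"
  using assms unfolding clique_def feasible_set_def non_edges_def by fastforce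

section \<open>Gluing and splitting measures\<close>

text \<open>The glued measure is the sum of the pushforwards under zero-padding: integrating \<open>h\<close> against a
  pushforward is integrating \<open>h\<close> composed with zero-padding.\<close>

lemma glue_measures:
  fixes C :: "'k \<Rightarrow> nat set"
  assumes "finite I" and \<nu>: "\<And>k. k \<in> I \<Longrightarrow> \<nu> k \<in> finite_borel_measures (C k)"
  obtains \<mu> where "\<mu> \<in> finite_borel_measures V"
    and "\<And>A. A \<in> sets (borel_on V) \<Longrightarrow>
      (\<And>k. k \<in> I \<Longrightarrow> AE y in \<nu> k. zero_pad V (C k) y \<in> A) \<Longrightarrow> AE x in \<mu>. x \<in> A"
    and "\<And>h :: _ \<Rightarrow> real. h \<in> borel_measurable (borel_on V) \<Longrightarrow>
      (\<And>k. k \<in> I \<Longrightarrow> integrable (\<nu> k) (restrict_fun V (C k) h)) \<Longrightarrow>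
      integrable \<mu> h \<and> (\<integral>x. h x \<partial>\<mu>) = (\<Sum>k\<in>I. \<integral>y. restrict_fun V (C k) h y \<partial>\<nu> k)"
proof -
  define \<rho> where "\<rho> k = distr (\<nu> k) (borel_on V) (zero_pad V (C k))" for k
  define \<mu> where "\<mu> = sum_measure (borel_on V) I \<rho>"
  have pad: "zero_pad V (C k) \<in> \<nu> k \<rightarrow>\<^sub>M borel_on V" if "k \<in> I" for k
    using \<nu>[OF that] measurable_cong_sets[OF _ refl] measurable_zero_pad
    by (auto simp: finite_borel_measures_def)
  have sets: "sets (\<rho> k) = sets (borel_on V)" for k
    by (simp add: \<rho>_def)
  show thesis
  proof (rule that[of \<mu>])
    have "finite_measure (\<rho> k)" if "k \<in> I" for k
      using \<nu>[OF that] finite_measure.finite_measure_distr[OF _ pad[OF that]]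
      by (simp add: finite_borel_measures_def \<rho>_def)
    then show "\<mu> \<in> finite_borel_measures V"
      using \<open>finite I\<close> sets
      by (simp add: finite_borel_measures_def \<mu>_def finite_measure_sum_measure)
  next
    fix A assume A: "A \<in> sets (borel_on V)"
      and ae: "\<And>k. k \<in> I \<Longrightarrow> AE y in \<nu> k. zero_pad V (C k) y \<in> A"
    have "emeasure (\<rho> k) (space (borel_on V) - A) = 0" if "k \<in> I" for k
    proof -
      have "AE x in \<rho> k. x \<in> A"
        unfolding \<rho>_def using A ae[OF that] pad[OF that]
        by (subst AE_distr_iff) auto
      then have "AE x in \<rho> k. x \<notin> space (borel_on V) - A"
        by auto
      then show ?thesis
        using A sets by (intro AE_iff_null_sets[THEN iffD2, THEN null_setsD1]) auto
    qed
    then have "space (borel_on V) - A \<in> null_sets \<mu>"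
      using A sets by (intro null_setsI) (auto simp: \<mu>_def emeasure_sum_measure)
    then have "AE x in \<mu>. x \<notin> space (borel_on V) - A"
      by (rule AE_not_in)
    then show "AE x in \<mu>. x \<in> A"
      by (rule AE_mp) (auto simp: \<mu>_def intro!: AE_I2)
  next
    fix h :: "_ \<Rightarrow> real"
    assume h: "h \<in> borel_measurable (borel_on V)"
      and int: "\<And>k. k \<in> I \<Longrightarrow> integrable (\<nu> k) (restrict_fun V (C k) h)"
    have "integrable (\<rho> k) h" if "k \<in> I" for k
      unfolding \<rho>_def using int[OF that]
      by (subst integrable_distr_eq[OF pad[OF that] h]) (simp add: restrict_fun_def)
    moreover have "(\<integral>x. h x \<partial>\<rho> k) = (\<integral>y. restrict_fun V (C k) h y \<partial>\<nu> k)" if "k \<in> I" for k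
      unfolding \<rho>_def by (subst integral_distr[OF pad[OF that] h]) (simp add: restrict_fun_def)
    ultimately show "integrable \<mu> h \<and>
        (\<integral>x. h x \<partial>\<mu>) = (\<Sum>k\<in>I. \<integral>y. restrict_fun V (C k) h y \<partial>\<nu> k)"
      unfolding \<mu>_def using \<open>finite I\<close> sets h
      by (simp add: integrable_sum_measure integral_sum_measure)
  qed
qed

text \<open>Zero-padding undoes the restriction to the coordinates in \<open>C k\<close> exactly at points supported in
  \<open>C k\<close>, so each part of \<open>\<mu>\<close> living on such points can be moved to the coordinates in \<open>C k\<close>
  without loss. Points whose support lies in several of the sets \<open>C k\<close> must be counted once only. They are
  assigned to the least such index. Each piece is then a Boolean combination of finitely many of the
  sets of points supported in some \<open>C k\<close>, hence measurable.\<close>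

lemma split_measure:
  fixes C :: "nat \<Rightarrow> nat set" and I :: "nat set"
  assumes "finite I" and "finite V" and C: "\<And>k. k \<in> I \<Longrightarrow> C k \<subseteq> V"
    and \<mu>: "\<mu> \<in> finite_borel_measures V"
    and cover: "AE x in \<mu>. \<exists>k\<in>I. {i \<in> V. x i \<noteq> 0} \<subseteq> C k"
  obtains \<nu> where "\<And>k. k \<in> I \<Longrightarrow> \<nu> k \<in> finite_borel_measures (C k)"
    and "\<And>k A. k \<in> I \<Longrightarrow> A \<in> sets (borel_on V) \<Longrightarrow> AE x in \<mu>. x \<in> A \<Longrightarrow>
      AE y in \<nu> k. zero_pad V (C k) y \<in> A"
    and "\<And>k h :: _ \<Rightarrow> real. k \<in> I \<Longrightarrow> h \<in> borel_measurable (borel_on V) \<Longrightarrow> integrable \<mu> h \<Longrightarrow>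
      integrable (\<nu> k) (restrict_fun V (C k) h)"
    and "\<And>h :: _ \<Rightarrow> real. h \<in> borel_measurable (borel_on V) \<Longrightarrow> integrable \<mu> h \<Longrightarrow>
      (\<Sum>k\<in>I. \<integral>y. restrict_fun V (C k) h y \<partial>\<nu> k) = (\<integral>x. h x \<partial>\<mu>)"
proof -
  define B where "B k = {x \<in> space (borel_on V). k \<in> I \<and> (\<forall>i\<in>V - C k. x i = 0)}" for k
  define D where "D = disjointed B"
  define \<nu> where "\<nu> k = distr (density \<mu> (indicator (D k))) (borel_on (C k)) (\<lambda>x. restrict x (C k))"
    for k
  have sets\<mu> [measurable_cong]: "sets \<mu> = sets (borel_on V)" and fin: "finite_measure \<mu>"
    using \<mu> by (auto simp: finite_borel_measures_def)
  have space\<mu>: "space \<mu> = space (borel_on V)"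
    by (rule sets_eq_imp_space_eq[OF sets\<mu>])
  have "B k \<in> sets (borel_on V)" for k
    unfolding B_def using \<open>finite V\<close> by measurable
  then have "range D \<subseteq> sets (borel_on V)"
    unfolding D_def by (intro sets.range_disjointed_sets) auto
  then have D_sets: "D k \<in> sets (borel_on V)" for k by auto
  then have [measurable]: "D k \<in> sets \<mu>" for k by (simp add: sets\<mu>)
  have D: "zero_pad V (C k) (restrict x (C k)) = x" if "x \<in> D k" for k x
    using that disjointed_subset[of B k]
    by (intro zero_pad_restrict) (auto simp: D_def B_def)
  have restr: "(\<lambda>x. restrict x (C k)) \<in> \<mu> \<rightarrow>\<^sub>M borel_on (C k)" if "k \<in> I" for k
    using measurable_restrict_subset[OF C[OF that], of "\<lambda>_. borel"]
    by (simp cong: measurable_cong_sets add: sets\<mu>)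
  then have restr': "(\<lambda>x. restrict x (C k)) \<in> density \<mu> (indicator (D k)) \<rightarrow>\<^sub>M borel_on (C k)"
    if "k \<in> I" for k using that by simp
  have total: "AE x in \<mu>. (\<Sum>k\<in>I. indicator (D k) x) = (1::real)"
    using cover AE_space
  proof eventually_elim
    case (elim x)
    then obtain k where "k \<in> I" "x \<in> B k"
      by (auto simp: B_def space\<mu>)
    then have "x \<in> (\<Union>k. D k)"
      unfolding D_def UN_disjointed_eq by blast
    then obtain l where l: "x \<in> D l" by blast
    moreover have "l \<in> I"
      using l disjointed_subset[of B l] by (auto simp: D_def B_def)
    ultimately have "x \<in> (\<Union>k\<in>I. D k)" by blast
    moreover have "disjoint_family_on D I"
      using disjoint_family_disjointed[of B] by (auto simp: D_def disjoint_family_on_def)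
    ultimately show ?case
      using indicator_UN_disjoint[OF \<open>finite I\<close>, of D x] by simp
  qed
  have push: "integrable (\<nu> k) (restrict_fun V (C k) h) \<and>
      (\<integral>y. restrict_fun V (C k) h y \<partial>\<nu> k) = (\<integral>x. indicator (D k) x * h x \<partial>\<mu>)"
    if k: "k \<in> I" and h: "h \<in> borel_measurable (borel_on V)" "integrable \<mu> h"
    for k and h :: "_ \<Rightarrow> real"
  proof -
    have rf: "restrict_fun V (C k) h \<in> borel_measurable (borel_on (C k))"
      unfolding restrict_fun_def using h(1) by measurable
    note rf' = measurable_compose[OF restr[OF k] rf]
    have eq: "indicator (D k) x *\<^sub>R restrict_fun V (C k) h (restrict x (C k)) = indicator (D k) x * h x"
      for x by (auto simp: restrict_fun_def D split: split_indicator)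
    have dens: "density \<mu> (indicator (D k)) = density \<mu> (\<lambda>x. ennreal (indicator (D k) x))"
      by (simp add: ennreal_indicator)
    have "integrable \<mu> (\<lambda>x. indicator (D k) x * h x)"
      using integrable_mult_indicator[of "D k" \<mu> h] h(2) by simp
    then have "integrable (density \<mu> (indicator (D k)))
        (\<lambda>x. restrict_fun V (C k) h (restrict x (C k)))"
      unfolding dens using rf' by (subst integrable_density) (auto simp: eq simp del: real_scaleR_def)
    moreover have "(\<integral>x. restrict_fun V (C k) h (restrict x (C k)) \<partial>density \<mu> (indicator (D k)))
        = (\<integral>x. indicator (D k) x * h x \<partial>\<mu>)"
      unfolding dens using rf' by (subst integral_density) (auto simp: eq simp del: real_scaleR_def)
    ultimately show ?thesis
      unfolding \<nu>_def using restr'[OF k] rf by (simp add: integrable_distr_eq integral_distr)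
  qed
  show thesis
  proof (rule that[of \<nu>])
    fix k assume k: "k \<in> I"
    have "finite_measure (density \<mu> (indicator (D k)))"
      using fin by (intro finite_measure.finite_measure_restricted) auto
    then show "\<nu> k \<in> finite_borel_measures (C k)"
      using restr'[OF k]
      by (simp add: finite_borel_measures_def \<nu>_def finite_measure.finite_measure_distr)
  next
    fix k A assume k: "k \<in> I" and A: "A \<in> sets (borel_on V)" and ae: "AE x in \<mu>. x \<in> A"
    have "{y \<in> space (borel_on (C k)). zero_pad V (C k) y \<in> A} \<in> sets (borel_on (C k))"
      using A by measurable
    moreover have "AE x in density \<mu> (indicator (D k)). zero_pad V (C k) (restrict x (C k)) \<in> A"
      using ae by (subst AE_density) (auto simp: D split: split_indicator)
    ultimately show "AE y in \<nu> k. zero_pad V (C k) y \<in> A"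
      unfolding \<nu>_def by (subst AE_distr_iff[OF restr'[OF k]])
  next
    fix k and h :: "_ \<Rightarrow> real"
    assume "k \<in> I" "h \<in> borel_measurable (borel_on V)" "integrable \<mu> h"
    then show "integrable (\<nu> k) (restrict_fun V (C k) h)"
      using push by blast
  next
    fix h :: "_ \<Rightarrow> real"
    assume h: "h \<in> borel_measurable (borel_on V)" "integrable \<mu> h"
    have "(\<Sum>k\<in>I. \<integral>y. restrict_fun V (C k) h y \<partial>\<nu> k) = (\<Sum>k\<in>I. \<integral>x. indicator (D k) x * h x \<partial>\<mu>)"
      using push h by simp
    also have "\<dots> = (\<integral>x. (\<Sum>k\<in>I. indicator (D k) x * h x) \<partial>\<mu>)"
      using integrable_mult_indicator[of "D _" \<mu> h] h(2) by (subst Bochner_Integration.integral_sum) simp_all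
    also have "\<dots> = (\<integral>x. h x \<partial>\<mu>)"
    proof (rule integral_cong_AE)
      have hm: "h \<in> borel_measurable \<mu>" using h(2) by simp
      then show "(\<lambda>x. \<Sum>k\<in>I. indicator (D k) x * h x) \<in> borel_measurable \<mu>" by measurable
      show "h \<in> borel_measurable \<mu>" by (rule hm)
      show "AE x in \<mu>. (\<Sum>k\<in>I. indicator (D k) x * h x) = h x"
        using total by eventually_elim (simp flip: sum_distrib_right)
    qed
    finally show "(\<Sum>k\<in>I. \<integral>y. restrict_fun V (C k) h y \<partial>\<nu> k) = (\<integral>x. h x \<partial>\<mu>)" .
  qed
qed

section \<open>Equivalence of the two problems\<close>

lemma supported_in_clique_feasible_set_iff_AE:
  assumes "\<And>j. j \<in> {1..m} \<Longrightarrow> g j \<in> polys n" and "\<nu> \<in> finite_borel_measures U"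
  shows "supported_in \<nu> (clique_feasible_set n E m g U)
    \<longleftrightarrow> (AE y in \<nu>. zero_pad {1..n} U y \<in> feasible_set n E m g)"
proof -
  have sets: "sets \<nu> = sets (borel_on U)"
    using assms(2) by (simp add: finite_borel_measures_def)
  have "supported_in \<nu> (clique_feasible_set n E m g U)
      \<longleftrightarrow> (AE y in \<nu>. y \<in> clique_feasible_set n E m g U)"
    using sets_clique_feasible_set[OF assms(1)] sets by (intro supported_in_iff_AE) auto
  also have "\<dots> \<longleftrightarrow> (AE y in \<nu>. zero_pad {1..n} U y \<in> feasible_set n E m g)"
    using sets_eq_imp_space_eq[OF sets] by (intro AE_cong) (simp add: clique_feasible_set_def)
  finally show ?thesis .
qed

theorem proposition6:
  fixes n p m N :: nat
    and E :: "nat set set"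
    and C :: "nat \<Rightarrow> nat set"
    and f g :: "nat \<Rightarrow> rpoly"
    and a :: "nat \<Rightarrow> real"
  assumes "graph_on {1..n} E"
    and "bij_betw C {1..p} {W. maximal_clique {1..n} E W}"
    and "\<And>i. i \<in> {0..N} \<Longrightarrow> f i \<in> polys n"
    and "\<And>j. j \<in> {1..m} \<Longrightarrow> g j \<in> polys n"
  shows "dense_val n E m g N f a = sparse_val n E p C m g N f a"
proof -
  let ?V = "{1..n}" and ?I = "{1..p}" and ?K = "feasible_set n E m g"
  let ?f = "\<lambda>i. peval (f i)"
  note f = measurable_peval[OF assms(3)]
  have K: "?K \<in> sets (borel_on ?V)"
    by (rule sets_feasible_set) (rule assms(4))
  have supp_iff: "supported_in \<nu> (clique_feasible_set n E m g U)
      \<longleftrightarrow> (AE y in \<nu>. zero_pad ?V U y \<in> ?K)" if "\<nu> \<in> finite_borel_measures U" for \<nu> U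
    by (rule supported_in_clique_feasible_set_iff_AE[OF _ that]) (rule assms(4))
  have CV: "C k \<subseteq> ?V" if "k \<in> ?I" for k
    using bij_betwE[OF assms(2)] that by (auto simp: maximal_clique_def clique_def)
  have supp: "\<exists>k\<in>?I. {i \<in> ?V. x i \<noteq> 0} \<subseteq> C k" if x: "x \<in> ?K" for x
  proof -
    obtain W where "maximal_clique ?V E W" "{i \<in> ?V. x i \<noteq> 0} \<subseteq> W"
      using clique_subset_maximal_clique[OF _ clique_support[OF x]] by blast
    then show ?thesis
      using bij_betw_imp_surj_on[OF assms(2)] by (metis (no_types, lifting) imageE mem_Collect_eq)
  qed
  have to_sparse: "\<exists>\<nu>. sparse_feasible n E p C m g N f a \<nu> \<and>
      (\<Sum>k\<in>?I. \<integral>y. restrict_fun ?V (C k) (?f 0) y \<partial>\<nu> k) = (\<integral>x. ?f 0 x \<partial>\<mu>)"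
    if \<mu>: "dense_feasible n E m g N f a \<mu>" for \<mu>
  proof -
    have fm: "\<mu> \<in> finite_borel_measures ?V"
      and int: "\<And>i. i \<in> {0..N} \<Longrightarrow> integrable \<mu> (?f i)"
      and a: "\<And>i. i \<in> {1..N} \<Longrightarrow> (\<integral>x. ?f i x \<partial>\<mu>) = a i"
      using \<mu> by (auto simp: dense_feasible_def)
    have ae: "AE x in \<mu>. x \<in> ?K"
      using \<mu> K supported_in_iff_AE[of ?K \<mu>]
      by (auto simp: dense_feasible_def finite_borel_measures_def)
    then have cover: "AE x in \<mu>. \<exists>k\<in>?I. {i \<in> ?V. x i \<noteq> 0} \<subseteq> C k"
      by eventually_elim (rule supp)
    show ?thesis
    proof (rule split_measure[OF finite_atLeastAtMost finite_atLeastAtMost CV fm cover])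
      fix \<nu>
      assume \<nu>: "\<And>k. k \<in> ?I \<Longrightarrow> \<nu> k \<in> finite_borel_measures (C k)"
        "\<And>k A. k \<in> ?I \<Longrightarrow> A \<in> sets (borel_on ?V) \<Longrightarrow> AE x in \<mu>. x \<in> A \<Longrightarrow>
          AE y in \<nu> k. zero_pad ?V (C k) y \<in> A"
        "\<And>k h :: _ \<Rightarrow> real. k \<in> ?I \<Longrightarrow> h \<in> borel_measurable (borel_on ?V) \<Longrightarrow> integrable \<mu> h \<Longrightarrow>
          integrable (\<nu> k) (restrict_fun ?V (C k) h)"
        "\<And>h :: _ \<Rightarrow> real. h \<in> borel_measurable (borel_on ?V) \<Longrightarrow> integrable \<mu> h \<Longrightarrow>
          (\<Sum>k\<in>?I. \<integral>y. restrict_fun ?V (C k) h y \<partial>\<nu> k) = (\<integral>x. h x \<partial>\<mu>)"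
      have "sparse_feasible n E p C m g N f a \<nu>"
        unfolding sparse_feasible_def
      proof (intro conjI ballI)
        fix i assume "i \<in> {1..N}"
        then show "(\<Sum>k\<in>?I. \<integral>y. restrict_fun ?V (C k) (?f i) y \<partial>\<nu> k) = a i"
          using \<nu>(4)[OF f int, of i] a by simp
      next
        fix k assume k: "k \<in> ?I"
        show "supported_in (\<nu> k) (clique_feasible_set n E m g (C k))"
          using supp_iff[OF \<nu>(1)[OF k]] \<nu>(2)[OF k K ae]
          by simp
      qed (use \<nu>(1) \<nu>(3) f int in blast)+
      then show ?thesis
        using \<nu>(4)[OF f int, of 0] by auto
    qed
  qed
  have to_dense: "\<exists>\<mu>. dense_feasible n E m g N f a \<mu> \<and>
      (\<integral>x. ?f 0 x \<partial>\<mu>) = (\<Sum>k\<in>?I. \<integral>y. restrict_fun ?V (C k) (?f 0) y \<partial>\<nu> k)"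
    if \<nu>: "sparse_feasible n E p C m g N f a \<nu>" for \<nu>
  proof -
    have fm: "\<nu> k \<in> finite_borel_measures (C k)" if "k \<in> ?I" for k
      using \<nu> that by (auto simp: sparse_feasible_def)
    have int: "integrable (\<nu> k) (restrict_fun ?V (C k) (?f i))" if "k \<in> ?I" "i \<in> {0..N}" for k i
      using \<nu> that by (auto simp: sparse_feasible_def)
    have ae: "AE y in \<nu> k. zero_pad ?V (C k) y \<in> ?K" if "k \<in> ?I" for k
      using \<nu> that supp_iff[OF fm[OF that]] by (simp add: sparse_feasible_def)
    show ?thesis
    proof (rule glue_measures[OF finite_atLeastAtMost fm, where V = ?V])
      fix \<mu>
      assume \<mu>: "\<mu> \<in> finite_borel_measures ?V"
        "\<And>A. A \<in> sets (borel_on ?V) \<Longrightarrow>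
          (\<And>k. k \<in> ?I \<Longrightarrow> AE y in \<nu> k. zero_pad ?V (C k) y \<in> A) \<Longrightarrow> AE x in \<mu>. x \<in> A"
        "\<And>h :: _ \<Rightarrow> real. h \<in> borel_measurable (borel_on ?V) \<Longrightarrow>
          (\<And>k. k \<in> ?I \<Longrightarrow> integrable (\<nu> k) (restrict_fun ?V (C k) h)) \<Longrightarrow>
          integrable \<mu> h \<and> (\<integral>x. h x \<partial>\<mu>) = (\<Sum>k\<in>?I. \<integral>y. restrict_fun ?V (C k) h y \<partial>\<nu> k)"
      have h: "integrable \<mu> (?f i) \<and>
          (\<integral>x. ?f i x \<partial>\<mu>) = (\<Sum>k\<in>?I. \<integral>y. restrict_fun ?V (C k) (?f i) y \<partial>\<nu> k)"
        if "i \<in> {0..N}" for i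
        using \<mu>(3)[OF f[OF that]] int that by blast
      have "AE x in \<mu>. x \<in> ?K"
        using \<mu>(2)[OF K] ae by blast
      then have "supported_in \<mu> ?K"
        using K \<mu>(1) by (subst supported_in_iff_AE) (auto simp: finite_borel_measures_def)
      then have "dense_feasible n E m g N f a \<mu>"
        using \<mu>(1) h \<nu> by (auto simp: dense_feasible_def sparse_feasible_def)
      then show ?thesis
        using h[of 0] by auto
    qed
  qed
  have "{ereal (\<integral>x. ?f 0 x \<partial>\<mu>) | \<mu>. dense_feasible n E m g N f a \<mu>} =
      {ereal (\<Sum>k\<in>?I. \<integral>y. restrict_fun ?V (C k) (?f 0) y \<partial>\<nu> k) | \<nu>.
        sparse_feasible n E p C m g N f a \<nu>}"
  proof (intro set_eqI iffI)
    fix r assume "r \<in> {ereal (\<integral>x. ?f 0 x \<partial>\<mu>) | \<mu>. dense_feasible n E m g N f a \<mu>}"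
    then obtain \<mu> where "dense_feasible n E m g N f a \<mu>" "r = ereal (\<integral>x. ?f 0 x \<partial>\<mu>)" by blast
    with to_sparse[of \<mu>] show "r \<in> {ereal (\<Sum>k\<in>?I. \<integral>y. restrict_fun ?V (C k) (?f 0) y \<partial>\<nu> k) | \<nu>.
        sparse_feasible n E p C m g N f a \<nu>}" by force
  next
    fix r assume "r \<in> {ereal (\<Sum>k\<in>?I. \<integral>y. restrict_fun ?V (C k) (?f 0) y \<partial>\<nu> k) | \<nu>.
        sparse_feasible n E p C m g N f a \<nu>}"
    then obtain \<nu> where "sparse_feasible n E p C m g N f a \<nu>"
      "r = ereal (\<Sum>k\<in>?I. \<integral>y. restrict_fun ?V (C k) (?f 0) y \<partial>\<nu> k)" by blast
    with to_dense[of \<nu>] show "r \<in> {ereal (\<integral>x. ?f 0 x \<partial>\<mu>) | \<mu>. dense_feasible n E m g N f a \<mu>}"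
      by force
  qed
  then show ?thesis
    by (simp add: dense_val_def sparse_val_def)
qed

end
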